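(* A left non-degenerate solution $(X,r)$ is bijective if and only if $(X,\triangleright_r)$ is a rack.
   Context: A solution $(X,r)$ is a set $X$ with a map $r:X\times X\to X\times X$ satisfying the braid identity $(r\times \mathrm{id}_X)(\mathrm{id}_X\times r)(r\times\mathrm{id}_X)=(\mathrm{id}_X\times r)(r\times\mathrm{id}_X)(\mathrm{id}_X\times r)$; it is called bijective if $r$ is a bijection. Writing $r(a,b)=(\sigma_a(b),\tau_b(a))$, $r$ is left non-degenerate if every $\sigma_a$ is a bijection of $X$. The left shelf associated to a left non-degenerate solution $r$ is $(X,\triangleright_r)$ with $a\triangleright_r b:=\sigma_a\tau_{\sigma_b^{-1}(a)}(b)$. A left shelf is a non-empty set $X$ with an operation $\triangleright$ satisfying $a\triangleright(b\triangleright c)=(a\triangleright b)\triangleright(a\triangleright c)$; it is a (left) rack if for every $a\in X$ the map $L_a:b\mapsto a\triangleright b$ is bijective. *)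

theory Defs
  imports Main
begin

text \<open>
  The underlying set \<open>X\<close> is the universe of a type \<^typ>\<open>'a\<close>, hence non-empty, as required of a
  shelf. Triples associate to the right, \<open>(a, b, c) = (a, (b, c))\<close>.
\<close>

definition braid12 :: "('a \<times> 'a \<Rightarrow> 'a \<times> 'a) \<Rightarrow> 'a \<times> 'a \<times> 'a \<Rightarrow> 'a \<times> 'a \<times> 'a" where
  "braid12 r = (\<lambda>(a, b, c). (fst (r (a, b)), snd (r (a, b)), c))"

definition braid23 :: "('a \<times> 'a \<Rightarrow> 'a \<times> 'a) \<Rightarrow> 'a \<times> 'a \<times> 'a \<Rightarrow> 'a \<times> 'a \<times> 'a" where
  "braid23 r = map_prod id r"

definition solution :: "('a \<times> 'a \<Rightarrow> 'a \<times> 'a) \<Rightarrow> bool" where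
  "solution r \<longleftrightarrow>
     braid12 r \<circ> braid23 r \<circ> braid12 r = braid23 r \<circ> braid12 r \<circ> braid23 r"

text \<open>\<open>r (a, b) = (sigma r a b, tau r b a)\<close>; note the order of the arguments of \<open>tau\<close>.\<close>

definition sigma :: "('a \<times> 'a \<Rightarrow> 'a \<times> 'a) \<Rightarrow> 'a \<Rightarrow> 'a \<Rightarrow> 'a" where
  "sigma r a b = fst (r (a, b))"

definition tau :: "('a \<times> 'a \<Rightarrow> 'a \<times> 'a) \<Rightarrow> 'a \<Rightarrow> 'a \<Rightarrow> 'a" where
  "tau r b a = snd (r (a, b))"

definition left_nondegenerate :: "('a \<times> 'a \<Rightarrow> 'a \<times> 'a) \<Rightarrow> bool" where
  "left_nondegenerate r \<longleftrightarrow> (\<forall>a. bij (sigma r a))"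

definition assoc_shelf_op :: "('a \<times> 'a \<Rightarrow> 'a \<times> 'a) \<Rightarrow> 'a \<Rightarrow> 'a \<Rightarrow> 'a" where
  "assoc_shelf_op r a b = sigma r a (tau r (inv (sigma r b) a) b)"

definition left_shelf :: "('a \<Rightarrow> 'a \<Rightarrow> 'a) \<Rightarrow> bool" where
  "left_shelf f \<longleftrightarrow> (\<forall>a b c. f a (f b c) = f (f a b) (f a c))"

definition left_rack :: "('a \<Rightarrow> 'a \<Rightarrow> 'a) \<Rightarrow> bool" where
  "left_rack f \<longleftrightarrow> left_shelf f \<and> (\<forall>a. bij (f a))"

end

theory Submission
  imports Defs
begin

text \<open>
  Write \<open>a \<rhd> b\<close> for \<open>assoc_shelf_op r a b\<close>. Left non-degeneracy makes
  \<open>\<phi> (a, b) = (a, sigma r a b)\<close> a bijection of \<open>X \<times> X\<close>, and \<open>\<rhd>\<close> is designed so that \<open>\<phi>\<close>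
  turns \<open>r\<close> into a map that remembers nothing but \<open>\<rhd>\<close>:
  \<open>\<phi> \<circ> r \<circ> \<phi>\<inverse>\<close> sends \<open>(x, y)\<close> to \<open>(y, y \<rhd> x)\<close> (lemma \<open>conjugate_by_shear\<close>). This is a swap followed by
  \<open>(y, x) \<mapsto> (y, y \<rhd> x)\<close>, which acts on each fibre \<open>{y} \<times> X\<close> by the left translation by \<open>y\<close>. Hence
  \<open>r\<close> is bijective exactly when all left translations of \<open>\<rhd>\<close> are.

  A rack must also be self-distributive, and this is where the braid identity enters. Its three
  components show first that each \<open>sigma r a\<close> is an endomorphism of \<open>\<rhd>\<close> (lemma
  \<open>sigma_shelf_hom\<close>), and then that \<open>\<rhd>\<close> is a left shelf (lemma \<open>left_shelf_assoc_shelf_op\<close>).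
  Every triple of elements can be written as \<open>(a, sigma r a b, sigma r a (sigma r b c))\<close>, and in
  these coordinates \<open>r\<close> acts on neighbouring entries as above, so that the braid identity becomes
  the self-distributive law.
\<close>

definition shear :: "('a \<Rightarrow> 'b \<Rightarrow> 'c) \<Rightarrow> 'a \<times> 'b \<Rightarrow> 'a \<times> 'c" where
  "shear f = (\<lambda>(x, y). (x, f x y))"

lemma bij_shear_iff: "bij (shear f) \<longleftrightarrow> (\<forall>x. bij (f x))"
proof -
  have "inj (shear f) \<longleftrightarrow> (\<forall>x. inj (f x))"
    by (auto simp: inj_def shear_def)
  moreover have "surj (shear f) \<longleftrightarrow> (\<forall>x. surj (f x))"
    by (auto simp: surj_def shear_def)
  ultimately show ?thesis
    by (auto simp: bij_def)
qed

lemma sigma_surj_left_nondegenerate: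
  assumes "left_nondegenerate r"
  obtains b where "sigma r a b = c"
  using assms unfolding left_nondegenerate_def by (metis bij_pointE)

text \<open>
  Parametrising the left argument as \<open>sigma r b c\<close> removes the inverse from the definition of the
  shelf operation; left non-degeneracy makes every left argument of this form.
\<close>

lemma assoc_shelf_op_sigma:
  assumes "left_nondegenerate r"
  shows "assoc_shelf_op r (sigma r b c) b = sigma r (sigma r b c) (tau r c b)"
  using assms by (simp add: assoc_shelf_op_def left_nondegenerate_def bij_is_inj)

lemma conjugate_by_shear:
  assumes "left_nondegenerate r"
  shows "shear (sigma r) \<circ> r = shear (assoc_shelf_op r) \<circ> prod.swap \<circ> shear (sigma r)"
proof
  fix p :: "'a \<times> 'a"
  obtain b c where p: "p = (b, c)" by (cases p)
  have "r (b, c) = (sigma r b c, tau r c b)"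
    by (simp add: sigma_def tau_def)
  then show "(shear (sigma r) \<circ> r) p = (shear (assoc_shelf_op r) \<circ> prod.swap \<circ> shear (sigma r)) p"
    using assms by (simp add: p shear_def assoc_shelf_op_sigma)
qed

lemma bij_iff_bij_left_translations:
  assumes "left_nondegenerate r"
  shows "bij r \<longleftrightarrow> (\<forall>a. bij (assoc_shelf_op r a))"
proof -
  have \<phi>: "bij (shear (sigma r))"
    using assms by (simp add: bij_shear_iff left_nondegenerate_def)
  have swap: "bij (prod.swap :: 'a \<times> 'a \<Rightarrow> 'a \<times> 'a)"
    by simp
  have "bij r \<longleftrightarrow> bij (shear (sigma r) \<circ> r)"
    using bij_betw_comp_iff2[OF \<phi>, of r UNIV] by simp
  also have "\<dots> \<longleftrightarrow> bij (shear (assoc_shelf_op r) \<circ> (prod.swap \<circ> shear (sigma r)))"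
    by (simp add: conjugate_by_shear[OF assms] comp_assoc)
  also have "\<dots> \<longleftrightarrow> bij (shear (assoc_shelf_op r))"
    using bij_betw_comp_iff[OF bij_comp[OF \<phi> swap]] by metis
  finally show ?thesis
    by (simp add: bij_shear_iff)
qed

lemma solution_components:
  assumes "solution r"
  shows braid_fst: "sigma r (sigma r a b) (sigma r (tau r b a) c) = sigma r a (sigma r b c)"
    and braid_mid: "tau r (sigma r (tau r b a) c) (sigma r a b)
      = sigma r (tau r (sigma r b c) a) (tau r c b)"
    and braid_snd: "tau r c (tau r b a) = tau r (tau r c b) (tau r (sigma r b c) a)"
proof -
  have "(braid12 r \<circ> braid23 r \<circ> braid12 r) (a, b, c) = (braid23 r \<circ> braid12 r \<circ> braid23 r) (a, b, c)"
    using assms by (simp add: solution_def)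
  then show
    "sigma r (sigma r a b) (sigma r (tau r b a) c) = sigma r a (sigma r b c)"
    "tau r (sigma r (tau r b a) c) (sigma r a b) = sigma r (tau r (sigma r b c) a) (tau r c b)"
    "tau r c (tau r b a) = tau r (tau r c b) (tau r (sigma r b c) a)"
    by (simp_all add: braid12_def braid23_def sigma_def tau_def split_beta prod_eq_iff)
qed

text \<open>
  The middle component of the braid identity pushes \<open>sigma r a\<close> through the \<open>tau\<close> that occurs in
  the shelf operation, and the first component pushes it through the outer \<open>sigma\<close>.
\<close>

lemma sigma_shelf_hom:
  assumes "solution r" and "left_nondegenerate r"
  shows "sigma r a (assoc_shelf_op r d b) = assoc_shelf_op r (sigma r a d) (sigma r a b)"
proof -
  obtain c where d: "d = sigma r b c"
    using sigma_surj_left_nondegenerate[OF assms(2)] by metis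
  let ?y = "sigma r a b" and ?k = "sigma r (tau r b a) c"
  have z: "sigma r a d = sigma r ?y ?k"
    by (simp add: d braid_fst[OF assms(1)])
  have "assoc_shelf_op r (sigma r a d) ?y = sigma r (sigma r a d) (tau r ?k ?y)"
    unfolding z by (rule assoc_shelf_op_sigma[OF assms(2)])
  also have "\<dots> = sigma r (sigma r a d) (sigma r (tau r d a) (tau r c b))"
    by (simp add: braid_mid[OF assms(1)] d)
  also have "\<dots> = sigma r a (sigma r d (tau r c b))"
    by (rule braid_fst[OF assms(1)])
  also have "\<dots> = sigma r a (assoc_shelf_op r d b)"
    by (simp add: d assoc_shelf_op_sigma[OF assms(2)])
  finally show ?thesis by simp
qed

text \<open>
  The endomorphism property brings the two sides of the self-distributive law to the form
  \<open>sigma \<circ> sigma\<close> applied to the two sides of the third component of the braid identity. The first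
  two components identify the maps \<open>sigma \<circ> sigma\<close>.
\<close>

lemma left_shelf_assoc_shelf_op:
  assumes "solution r" and "left_nondegenerate r"
  shows "left_shelf (assoc_shelf_op r)"
  unfolding left_shelf_def
proof (intro allI)
  fix z y x
  \<comment> \<open>The braid identity is applied to the triple \<open>(x, b, c)\<close>, which \<open>r\<close> on the first two entries
    sends to \<open>(y, u, c)\<close> and \<open>r\<close> on the last two entries to \<open>(x, d, f)\<close>; from there the next step
    gives \<open>(y, k, tau r c u)\<close> and \<open>(z, e, f)\<close>.\<close>
  obtain b where y: "sigma r x b = y"
    by (rule sigma_surj_left_nondegenerate[OF assms(2)])
  obtain d where d: "sigma r x d = z"
    by (rule sigma_surj_left_nondegenerate[OF assms(2)])
  obtain c where c: "sigma r b c = d"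
    by (rule sigma_surj_left_nondegenerate[OF assms(2)])
  note op = assoc_shelf_op_sigma[OF assms(2)] and hom = sigma_shelf_hom[OF assms, symmetric]
  define u where "u = tau r b x"
  define k where "k = sigma r u c"
  define e where "e = tau r d x"
  define f where "f = tau r c b"
  have zk: "sigma r y k = z"
    using braid_fst[OF assms(1), of x b c] by (simp add: y d c u_def k_def)
  have mid: "tau r k y = sigma r e f"
    using braid_mid[OF assms(1), of b x c] by (simp add: y c u_def k_def e_def f_def)
  have snd: "tau r c u = tau r f e"
    using braid_snd[OF assms(1), of c b x] by (simp add: c u_def e_def f_def)

  have yx: "assoc_shelf_op r y x = sigma r y u"
    using op[of x b] by (simp add: y u_def)
  have ku: "assoc_shelf_op r k u = sigma r k (tau r c u)"
    using op[of u c] by (simp add: k_def)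
  have zx: "assoc_shelf_op r z x = sigma r z e"
    using op[of x d] by (simp add: d e_def)
  have db: "assoc_shelf_op r d b = sigma r d f"
    using op[of b c] by (simp add: c f_def)
  have zy: "assoc_shelf_op r z y = sigma r z (sigma r e f)"
    using hom[of x d b] braid_fst[OF assms(1), of x d f] by (simp add: y d db e_def)

  have "assoc_shelf_op r z (assoc_shelf_op r y x) = sigma r y (assoc_shelf_op r k u)"
    using hom[of y k u] by (simp add: yx zk)
  also have "\<dots> = sigma r y (sigma r k (tau r f e))"
    by (simp add: ku snd)
  also have "\<dots> = sigma r z (sigma r (sigma r e f) (tau r f e))"
    using braid_fst[OF assms(1), of y k "tau r f e"] by (simp add: zk mid)
  also have "\<dots> = sigma r z (assoc_shelf_op r (sigma r e f) e)"
    by (simp add: op)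
  also have "\<dots> = assoc_shelf_op r (assoc_shelf_op r z y) (assoc_shelf_op r z x)"
    by (simp add: zy zx hom)
  finally show "assoc_shelf_op r z (assoc_shelf_op r y x)
    = assoc_shelf_op r (assoc_shelf_op r z y) (assoc_shelf_op r z x)" .
qed

theorem corollary2p16:
  fixes r :: "'a \<times> 'a \<Rightarrow> 'a \<times> 'a"
  assumes "solution r" and "left_nondegenerate r"
  shows "bij r \<longleftrightarrow> left_rack (assoc_shelf_op r)"
  using left_shelf_assoc_shelf_op[OF assms] bij_iff_bij_left_translations[OF assms(2)]
  by (simp add: left_rack_def)

end
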